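(* For all integers $n\geq 1$ and $k\geq 2$, $$A_n^{(k)}(x)=\sum_{\sigma\in \mathcal{Q}_n(k)}x^{\mathrm{ap}(\sigma)},$$ where $A_n^{(k)}(x)$ is the $1/k$-Eulerian polynomial, $\mathcal{Q}_n(k)$ is the set of $k$-Stirling permutations of order $n$, and $\mathrm{ap}(\sigma)$ is the number of longest ascent-plateaus of $\sigma$.
   Context: For $k\geq 1$, the $1/k$-Eulerian polynomials $A_n^{(k)}(x)$ ($n\ge 0$) are defined by the exponential generating function (a formal power series in $z$, with the $k$-th root having constant term $1$) $$\sum_{n\geq 0}A_n^{(k)}(x)\frac{z^n}{n!}=\left(\frac{1-x}{e^{kz(x-1)}-x} \right)^{1/k}.$$ A $k$-Stirling permutation of order $n$ is a permutation $\sigma=\sigma_1\sigma_2\cdots\sigma_{kn}$ of the multiset $\{1^k,2^k,\ldots,n^k\}$ (each of $1,\dots,n$ appearing exactly $k$ times) such that for each $i$, $1\leq i\leq n$, all entries between any two occurrences of $i$ are at least $i$. The set of these is denoted $\mathcal{Q}_n(k)$. For $\sigma=\sigma_1\sigma_2\cdots\sigma_{kn}\in \mathcal{Q}_n(k)$, an index $i\in\{2,3,\ldots,nk-k+1\}$ is a longest ascent-plateau of $\sigma$ if $$\sigma_{i-1}<\sigma_i=\sigma_{i+1}=\cdots=\sigma_{i+k-1}.$$ The number of longest ascent-plateaus of $\sigma$ is denoted $\mathrm{ap}(\sigma)$. For example, for $k=3$, $n=3$, $\mathrm{ap}(112233321)=1$. *)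

theory Defs
  imports
    "HOL-Computational_Algebra.Computational_Algebra"
    "HOL-Combinatorics.Multiset_Permutations"
begin

text \<open>
  The variable \<open>x\<close> of the $1/k$-Eulerian polynomials is the indeterminate of the field of
  rational functions over \<open>\<rat>\<close>; this field is the coefficient ring of the formal power series
  in \<open>z\<close>. The library does not record that a field of fractions inherits characteristic 0,
  which \<^const>\<open>fps_exp\<close> and \<^const>\<open>fps_radical\<close> need.
\<close>

instance fract :: ("{idom, ring_char_0}") field_char_0
proof
  have of_nat: "(of_nat m :: 'a fract) = Fract (of_nat m) 1" for m
    by (simp add: Fract_of_nat_eq)
  show "inj (of_nat :: nat \<Rightarrow> 'a fract)"
    by (rule injI) (simp add: of_nat eq_fract)
qed

definition indet_x :: "rat poly fract" where
  "indet_x = Fract [:0, 1:] 1"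

text \<open>
  The first argument of \<^const>\<open>fps_radical\<close> supplies the root of the constant term of the
  series; that constant term is \<open>1\<close> here (\<open>eulerian_base_nth_0\<close>), and the
  root chosen is \<open>1\<close>.
\<close>

definition eulerian_base :: "nat \<Rightarrow> rat poly fract fps" where
  "eulerian_base k = fps_const (1 - indet_x) / (fps_exp (of_nat k * (indet_x - 1)) - fps_const indet_x)"

definition eulerian_egf :: "nat \<Rightarrow> rat poly fract fps" where
  "eulerian_egf k = fps_radical (\<lambda>_ _. 1) k (eulerian_base k)"

definition eulerian :: "nat \<Rightarrow> nat \<Rightarrow> rat poly fract" where
  "eulerian k n = fact n * fps_nth (eulerian_egf k) n"

lemma indet_x_neq_1: "indet_x \<noteq> 1"
  by (simp add: indet_x_def One_fract_def eq_fract one_pCons)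

lemma eulerian_base_nth_0: "fps_nth (eulerian_base k) 0 = 1"
  using indet_x_neq_1 by (simp add: eulerian_base_def fps_divide_unit)

lemma eulerian_egf_nth_0: "fps_nth (eulerian_egf k) 0 = 1"
  by (simp add: eulerian_egf_def)

lemma eulerian_egf_power:
  assumes "k \<ge> 1"
  shows "eulerian_egf k ^ k = eulerian_base k"
proof -
  obtain h where k: "k = Suc h"
    using assms by (cases k) auto
  show ?thesis
    using power_radical[of "eulerian_base k" "\<lambda>_ _. 1" h]
    unfolding k eulerian_egf_def by (simp add: eulerian_base_nth_0)
qed

lemma eulerian_egf_eq: "eulerian_egf k = Abs_fps (\<lambda>n. eulerian k n / fact n)"
  by (simp add: eulerian_def fps_eq_iff)

text \<open>
  Words are lists, so the \<open>i\<close>-th entry of \<open>\<sigma>\<close>, counted from 1, is \<open>\<sigma> ! (i - 1)\<close>.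
\<close>

definition stirling_perms :: "nat \<Rightarrow> nat \<Rightarrow> nat list set" where
  "stirling_perms k n =
    {\<sigma> \<in> permutations_of_multiset (\<Sum>i\<in>{1..n}. replicate_mset k i).
      \<forall>p r q. p < r \<and> r < q \<and> q < length \<sigma> \<and> \<sigma> ! p = \<sigma> ! q \<longrightarrow> \<sigma> ! r \<ge> \<sigma> ! p}"

definition longest_ascent_plateaus :: "nat \<Rightarrow> nat list \<Rightarrow> nat set" where
  "longest_ascent_plateaus k \<sigma> =
    {i \<in> {2..length \<sigma> - k + 1}.
      \<sigma> ! (i - 2) < \<sigma> ! (i - 1) \<and> (\<forall>j\<in>{i..i + k - 1}. \<sigma> ! (j - 1) = \<sigma> ! (i - 1))}"

definition ap :: "nat \<Rightarrow> nat list \<Rightarrow> nat" where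
  "ap k \<sigma> = card (longest_ascent_plateaus k \<sigma>)"

lemma finite_stirling_perms: "finite (stirling_perms k n)"
  by (simp add: stirling_perms_def)

lemma length_stirling_perms:
  assumes "\<sigma> \<in> stirling_perms k n"
  shows "length \<sigma> = k * n"
proof -
  have "mset \<sigma> = (\<Sum>i\<in>{1..n}. replicate_mset k i)"
    using assms by (simp add: stirling_perms_def permutations_of_multiset_def)
  then have "size (mset \<sigma>) = (\<Sum>i\<in>{1..n}. k)"
    by (simp add: size_multiset_sum)
  then show ?thesis
    by (simp add: mult.commute)
qed

lemma ap_example: "ap 3 [1, 1, 2, 2, 3, 3, 3, 2, 1] = 1"
proof -
  have "{2..7} = {2, 3, 4, 5, 6, 7::nat}"
    by auto
  then have "longest_ascent_plateaus 3 [1, 1, 2, 2, 3, 3, 3, 2, 1] = {5}"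
    by (auto simp: longest_ascent_plateaus_def atLeastAtMost_upt upt_rec nth_Cons')
  then show ?thesis
    by (simp add: ap_def)
qed

end

theory Submission
  imports Defs
begin

text \<open>
  Write \<open>F\<close> for the exponential generating function, \<open>B = F\<^sup>k\<close>, \<open>X = x B\<close> and
  \<open>U = 1 - x + x B\<close>. Then \<open>F' = F U\<close> and \<open>X' = U' = k X U\<close>. A word of order \<open>n + 1\<close> arises from
  exactly one word of order \<open>n\<close> by inserting the block of its \<open>k\<close> copies of \<open>n + 1\<close> at one of
  \<open>k n + 1\<close> places; \<open>1 + k a\<close> of these places keep the number \<open>a\<close> of longest ascent-plateaus and
  the other \<open>k (n - a)\<close> raise it by one. Differentiating \<open>F X\<^sup>a U\<^bsup>n - a\<^esup>\<close> with the
  above rules produces the same coefficients, so the \<open>n\<close>-th derivative of \<open>F\<close> is the sum of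
  \<open>F X\<^sup>a U\<^bsup>n - a\<^esup>\<close> over all words of order \<open>n\<close>. At \<open>z = 0\<close>, where \<open>F = U = 1\<close> and
  \<open>X = x\<close>, this is the claim.
\<close>

section \<open>Inserting a block of maximal letters\<close>

definition stirling_word :: "nat list \<Rightarrow> bool" where
  "stirling_word \<sigma> \<longleftrightarrow>
    (\<forall>p r q. p < r \<and> r < q \<and> q < length \<sigma> \<and> \<sigma> ! p = \<sigma> ! q \<longrightarrow> \<sigma> ! r \<ge> \<sigma> ! p)"

lemma stirling_wordD:
  "stirling_word \<sigma> \<Longrightarrow> p < r \<Longrightarrow> r < q \<Longrightarrow> q < length \<sigma> \<Longrightarrow> \<sigma> ! p = \<sigma> ! q \<Longrightarrow> \<sigma> ! p \<le> \<sigma> ! r"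
  unfolding stirling_word_def by blast

lemma stirling_perms_iff:
  "\<sigma> \<in> stirling_perms k n \<longleftrightarrow>
    mset \<sigma> = (\<Sum>i\<in>{1..n}. replicate_mset k i) \<and> stirling_word \<sigma>"
  by (simp add: stirling_perms_def permutations_of_multiset_def stirling_word_def)

lemma stirling_perms_letter_le:
  assumes "\<sigma> \<in> stirling_perms k n" "v \<in> set \<sigma>"
  shows "v \<le> n"
proof -
  have "v \<in># (\<Sum>i\<in>{1..n}. replicate_mset k i)"
    using assms by (metis set_mset_mset stirling_perms_iff)
  then show ?thesis
    by (auto simp: set_mset_sum split: if_splits)
qed

definition insert_block :: "nat \<Rightarrow> 'a \<Rightarrow> nat \<Rightarrow> 'a list \<Rightarrow> 'a list" where
  "insert_block k m p \<sigma> = take p \<sigma> @ replicate k m @ drop p \<sigma>"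

lemma length_insert_block: "p \<le> length \<sigma> \<Longrightarrow> length (insert_block k m p \<sigma>) = length \<sigma> + k"
  by (simp add: insert_block_def)

lemma nth_insert_block:
  assumes "p \<le> length \<sigma>" "i < length \<sigma> + k"
  shows "insert_block k m p \<sigma> ! i = (if i < p then \<sigma> ! i else if i < p + k then m else \<sigma> ! (i - k))"
  using assms by (auto simp: insert_block_def nth_append)

lemma mset_insert_block: "mset (insert_block k m p \<sigma>) = replicate_mset k m + mset \<sigma>"
proof -
  have "mset \<sigma> = mset (take p \<sigma>) + mset (drop p \<sigma>)"
    by (metis append_take_drop_id mset_append)
  then show ?thesis
    by (simp add: insert_block_def)
qed

text \<open>Since \<open>m\<close> exceeds every old letter, no pair of equal letters mixes old and
  new. Copies of \<open>m\<close> have only \<open>m\<close> between them, and a copy of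
  \<open>m\<close> between two equal old letters does no harm. All other instances of the condition
  are those of \<sigma>.\<close>

lemma stirling_word_insert_block:
  assumes p: "p \<le> length \<sigma>" and m: "\<forall>v\<in>set \<sigma>. v < m"
  shows "stirling_word (insert_block k m p \<sigma>) \<longleftrightarrow> stirling_word \<sigma>" (is "stirling_word ?\<tau> \<longleftrightarrow> _")
proof
  assume \<tau>: "stirling_word ?\<tau>"
  \<comment> \<open>\<open>g\<close> sends a position of \<sigma> to its position in the enlarged
    word; \<open>h\<close> below undoes this on the positions outside the block.\<close>
  define g where "g i = (if i < p then i else i + k)" for i
  have g: "\<sigma> ! i = ?\<tau> ! g i" if "i < length \<sigma>" for i
    using that p by (simp add: g_def nth_insert_block)
  have mono: "g i < g j" if "i < j" for i j
    using that by (auto simp: g_def)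
  have len: "g i < length ?\<tau>" if "i < length \<sigma>" for i
    using that p by (simp add: g_def length_insert_block)
  show "stirling_word \<sigma>"
    unfolding stirling_word_def
  proof (intro allI impI, elim conjE)
    fix a r b
    assume ab: "a < r" "r < b" "b < length \<sigma>" "\<sigma> ! a = \<sigma> ! b"
    then show "\<sigma> ! a \<le> \<sigma> ! r"
      using stirling_wordD[OF \<tau> mono[OF ab(1)] mono[OF ab(2)] len[OF ab(3)]] by (simp add: g)
  qed
next
  assume \<sigma>: "stirling_word \<sigma>"
  have lt: "\<sigma> ! i < m" if "i < length \<sigma>" for i
    using m that by simp
  define h where "h i = (if i < p then i else i - k)" for i
  define out where "out i \<longleftrightarrow> i < p \<or> p + k \<le> i" for i
  have h: "?\<tau> ! i = \<sigma> ! h i" "h i < length \<sigma>" if "i < length \<sigma> + k" "out i" for i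
    using that p by (auto simp: h_def out_def nth_insert_block)
  have blk: "?\<tau> ! i = m" if "i < length \<sigma> + k" "\<not> out i" for i
    using that p by (auto simp: out_def nth_insert_block)
  have mono: "h i < h j" if "i < j" "out i" "out j" for i j
    using that by (auto simp: h_def out_def)
  have le: "?\<tau> ! i \<le> m" if "i < length \<sigma> + k" for i
    using h[of i] blk[of i] lt[of "h i"] that by fastforce
  show "stirling_word ?\<tau>"
    unfolding stirling_word_def
  proof (intro allI impI, elim conjE)
    fix a r b
    assume ab: "a < r" "r < b" "b < length ?\<tau>" and eq: "?\<tau> ! a = ?\<tau> ! b"
    have len: "b < length \<sigma> + k" "r < length \<sigma> + k" "a < length \<sigma> + k"
      using ab p by (auto simp: length_insert_block)
    show "?\<tau> ! a \<le> ?\<tau> ! r"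
    proof (cases "out r")
      case False
      then show ?thesis
        using blk le len by simp
    next
      case r: True
      \<comment> \<open>The block is contiguous, so it cannot contain both \<open>a\<close> and
        \<open>b\<close> while \<open>r\<close> between them lies outside. Equal letters are either
        both inside or both outside, so both are outside.\<close>
      have ab_out: "out a \<or> out b"
        using r ab by (auto simp: out_def)
      have "out a \<longleftrightarrow> out b"
        using eq h blk lt len by (metis less_irrefl)
      then have "out a" "out b"
        using ab_out by auto
      then show ?thesis
        using stirling_wordD[OF \<sigma> mono[OF ab(1)] mono[OF ab(2)]] r h len eq by simp
    qed
  qed
qed

lemma insert_block_in_stirling_perms_iff:
  assumes "p \<le> length \<sigma>" "\<forall>v\<in>set \<sigma>. v < Suc n"
  shows "insert_block k (Suc n) p \<sigma> \<in> stirling_perms k (Suc n) \<longleftrightarrow> \<sigma> \<in> stirling_perms k n"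
  using stirling_word_insert_block[OF assms]
  by (simp add: stirling_perms_iff mset_insert_block add.commute)

text \<open>Between two occurrences of the largest letter only that letter can occur.\<close>

lemma stirling_perms_Suc_split:
  assumes \<tau>: "\<tau> \<in> stirling_perms k (Suc n)"
  shows "\<exists>a b. \<tau> = a @ replicate k (Suc n) @ b \<and> Suc n \<notin> set (a @ b)"
proof -
  define m where "m = Suc n"
  \<comment> \<open>\<open>a\<close> is everything before the first \<open>m\<close>,
    \<open>d\<close> the maximal run of \<open>m\<close> that follows, \<open>b\<close> the
    rest.\<close>
  define a where "a = takeWhile (\<lambda>v. v \<noteq> m) \<tau>"
  define c where "c = dropWhile (\<lambda>v. v \<noteq> m) \<tau>"
  define d where "d = takeWhile (\<lambda>v. v = m) c"
  define b where "b = dropWhile (\<lambda>v. v = m) c"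
  have eq: "\<tau> = a @ d @ b"
    by (simp add: a_def b_def c_def d_def)
  have a: "m \<notin> set a"
    by (auto simp: a_def dest: set_takeWhileD)
  have d: "d = replicate (length d) m"
    by (rule replicate_length_same[symmetric]) (auto simp: d_def dest: set_takeWhileD)
  \<comment> \<open>Otherwise the first letter \<open>y\<close> of \<open>b\<close>, which is
    smaller than \<open>m\<close>, stands between the run \<open>d\<close> and a later
    \<open>m\<close>.\<close>
  have b: "m \<notin> set b"
  proof
    assume mb: "m \<in> set b"
    then obtain y b' where yb: "b = y # b'"
      by (cases b) auto
    then have y: "y \<noteq> m"
      using b_def by (simp add: dropWhile_eq_Cons_conv)
    obtain j where j: "j < length b" "b ! j = m"
      using mb by (auto simp: in_set_conv_nth)
    have "j \<noteq> 0"
      using j y yb by (cases j) auto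
    have "c \<noteq> []"
      using mb b_def by auto
    then have "hd c = m"
      using hd_dropWhile[of "\<lambda>v. v \<noteq> m" \<tau>] by (simp add: c_def)
    then have d0: "d \<noteq> []" "d ! 0 = m"
      using \<open>c \<noteq> []\<close> unfolding d_def by (cases c; simp)+
    have "\<tau> ! length a = m" "\<tau> ! (length a + length d) = y" "\<tau> ! (length a + length d + j) = m"
      using d0 j yb by (auto simp: eq nth_append)
    moreover have "length a + length d + j < length \<tau>"
      using j by (simp add: eq)
    moreover have "stirling_word \<tau>"
      using \<tau> by (simp add: stirling_perms_iff)
    ultimately have "m \<le> y"
      using stirling_wordD[of \<tau> "length a" "length a + length d" "length a + length d + j"]
        d0 \<open>j \<noteq> 0\<close> by auto
    moreover have "y \<le> m"
      using stirling_perms_letter_le[OF \<tau>, of y] yb by (simp add: m_def eq)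
    ultimately show False
      using y by simp
  qed
  have "count (mset \<tau>) m = k"
    using \<tau> by (simp add: stirling_perms_iff m_def count_sum)
  moreover have "count (mset \<tau>) m = length d"
    using a b by (subst eq, subst d) (simp add: count_mset_0_iff)
  ultimately show ?thesis
    using eq d a b unfolding m_def by auto
qed

lemma bij_betw_insert_block:
  assumes k: "k \<ge> 1"
  shows "bij_betw (\<lambda>(\<sigma>, p). insert_block k (Suc n) p \<sigma>)
    (stirling_perms k n \<times> {..k * n}) (stirling_perms k (Suc n))"
proof (rule bij_betw_imageI)
  define m where "m = Suc n"
  have lt: "\<forall>v\<in>set \<sigma>. v < Suc n" if "\<sigma> \<in> stirling_perms k n" for \<sigma>
    using stirling_perms_letter_le[OF that] by (simp add: less_Suc_eq_le)
  show "inj_on (\<lambda>(\<sigma>, p). insert_block k (Suc n) p \<sigma>) (stirling_perms k n \<times> {..k * n})"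
  \<comment> \<open>The left inverse erases every \<open>m\<close> and recovers \<open>p\<close> as
    the number of letters before the first \<open>m\<close>; such an \<open>m\<close> exists because
    \<open>k \<ge> 1\<close>.\<close>
  proof (rule inj_on_inverseI)
    fix z assume "z \<in> stirling_perms k n \<times> {..k * n}"
    then obtain \<sigma> p where z: "z = (\<sigma>, p)" "\<sigma> \<in> stirling_perms k n" "p \<le> length \<sigma>"
      by (auto simp: length_stirling_perms)
    have ne: "\<forall>v\<in>set \<sigma>. v \<noteq> m"
      using lt[OF z(2)] by (auto simp: m_def)
    have tk: "\<forall>v\<in>set (take p \<sigma>). v \<noteq> m" and dr: "\<forall>v\<in>set (drop p \<sigma>). v \<noteq> m"
      using ne by (meson in_set_takeD, meson ne in_set_dropD)
    have "filter (\<lambda>v. v \<noteq> m) (insert_block k m p \<sigma>) = take p \<sigma> @ drop p \<sigma>"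
      using tk dr by (simp add: insert_block_def filter_id_conv)
    moreover have "takeWhile (\<lambda>v. v \<noteq> m) (insert_block k m p \<sigma>) = take p \<sigma>"
      using tk k by (cases k) (simp_all add: insert_block_def takeWhile_append)
    ultimately show "(\<lambda>\<tau>. (filter (\<lambda>v. v \<noteq> m) \<tau>, length (takeWhile (\<lambda>v. v \<noteq> m) \<tau>)))
        ((\<lambda>(\<sigma>, p). insert_block k (Suc n) p \<sigma>) z) = z"
      using z by (simp add: m_def)
  qed
  show "(\<lambda>(\<sigma>, p). insert_block k (Suc n) p \<sigma>) ` (stirling_perms k n \<times> {..k * n})
    = stirling_perms k (Suc n)"
  proof (intro equalityI subsetI)
    fix \<tau> assume "\<tau> \<in> (\<lambda>(\<sigma>, p). insert_block k (Suc n) p \<sigma>) ` (stirling_perms k n \<times> {..k * n})"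
    then show "\<tau> \<in> stirling_perms k (Suc n)"
      using insert_block_in_stirling_perms_iff lt by (auto simp: length_stirling_perms)
  next
    fix \<tau> assume \<tau>: "\<tau> \<in> stirling_perms k (Suc n)"
    then obtain a b where ab: "\<tau> = a @ replicate k (Suc n) @ b" "Suc n \<notin> set (a @ b)"
      using stirling_perms_Suc_split by blast
    have \<tau>_eq: "\<tau> = insert_block k (Suc n) (length a) (a @ b)"
      by (simp add: ab insert_block_def)
    have "\<forall>v\<in>set (a @ b). v < Suc n"
    proof
      fix v assume "v \<in> set (a @ b)"
      then show "v < Suc n"
        using stirling_perms_letter_le[OF \<tau>, of v] ab
        by (cases "v = Suc n") (auto simp: le_less)
    qed
    then have in_n: "a @ b \<in> stirling_perms k n"
      using insert_block_in_stirling_perms_iff[of "length a" "a @ b" n k] \<tau> \<tau>_eq by simp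
    then have "length a \<le> k * n"
      using length_stirling_perms[OF in_n] by simp
    with in_n show "\<tau> \<in> (\<lambda>(\<sigma>, p). insert_block k (Suc n) p \<sigma>) ` (stirling_perms k n \<times> {..k * n})"
      using \<tau>_eq by (intro image_eqI[of _ _ "(a @ b, length a)"]) auto
  qed
qed

section \<open>Longest ascent-plateaus after an insertion\<close>

definition plateau_starts :: "nat \<Rightarrow> nat list \<Rightarrow> nat set" where
  "plateau_starts k \<sigma> =
    {j. 1 \<le> j \<and> j + k \<le> length \<sigma> \<and> \<sigma> ! (j - 1) < \<sigma> ! j \<and> (\<forall>t<k. \<sigma> ! (j + t) = \<sigma> ! j)}"

lemma finite_plateau_starts: "finite (plateau_starts k \<sigma>)"
  by (rule finite_subset[of _ "{..length \<sigma>}"]) (auto simp: plateau_starts_def)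

text \<open>\<^const>\<open>longest_ascent_plateaus\<close> counts entries from 1, \<^const>\<open>plateau_starts\<close> from 0.\<close>

lemma ap_eq_card_plateau_starts:
  assumes "k \<ge> 1"
  shows "ap k \<sigma> = card (plateau_starts k \<sigma>)"
proof -
  have "longest_ascent_plateaus k \<sigma> = Suc ` plateau_starts k \<sigma>"
  proof (intro equalityI subsetI)
    fix i assume i: "i \<in> longest_ascent_plateaus k \<sigma>"
    then have "2 \<le> i"
      by (simp add: longest_ascent_plateaus_def)
    then obtain j where j: "i = Suc j" "1 \<le> j"
      by (cases i) auto
    have "\<sigma> ! (j + t) = \<sigma> ! j" if "t < k" for t
    proof -
      have "Suc (j + t) \<in> {i..i + k - 1}"
        using that j by auto
      then show ?thesis
        using i j unfolding longest_ascent_plateaus_def by fastforce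
    qed
    then have "j \<in> plateau_starts k \<sigma>"
      using i j by (auto simp: longest_ascent_plateaus_def plateau_starts_def)
    then show "i \<in> Suc ` plateau_starts k \<sigma>"
      using j by blast
  next
    fix i assume "i \<in> Suc ` plateau_starts k \<sigma>"
    then obtain j where j: "i = Suc j" "j \<in> plateau_starts k \<sigma>"
      by blast
    have "\<sigma> ! (l - 1) = \<sigma> ! j" if "l \<in> {i..i + k - 1}" for l
    proof -
      have "l - 1 = j + (l - i)" "l - i < k"
        using that j assms by auto
      then show ?thesis
        using j by (simp add: plateau_starts_def)
    qed
    then show "i \<in> longest_ascent_plateaus k \<sigma>"
      using j by (auto simp: longest_ascent_plateaus_def plateau_starts_def)
  qed
  then show ?thesis
    by (simp add: ap_def card_image)
qed

text \<open>If \<open>i < j < i + k\<close>, then positions \<open>j - 1\<close> and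
  \<open>j\<close> both lie in the constant run starting at \<open>i\<close>, which contradicts the
  ascent at \<open>j\<close>.\<close>

lemma plateau_starts_disjoint:
  assumes "i \<in> plateau_starts k \<sigma>" "j \<in> plateau_starts k \<sigma>" "i < j"
  shows "i + k \<le> j"
proof (rule ccontr)
  assume "\<not> i + k \<le> j"
  then have "j - i < k" "j - i - 1 < k"
    using assms(3) by linarith+
  moreover have "i + (j - i) = j" "i + (j - i - 1) = j - 1"
    using assms(3) by auto
  ultimately have "\<sigma> ! j = \<sigma> ! i" "\<sigma> ! (j - 1) = \<sigma> ! i"
    using assms(1) unfolding plateau_starts_def by (metis (mono_tags, lifting) mem_Collect_eq)+
  then show False
    using assms(2) by (simp add: plateau_starts_def)
qed

text \<open>The block is a plateau of its own unless nothing precedes it. An old plateau survives if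
  it ends by \<open>p\<close> or starts after \<open>p\<close>. One starting at \<open>j\<close>
  with \<open>j \<le> p < j + k\<close> is lost: for \<open>j < p\<close> its run is cut, and for
  \<open>j = p\<close> its ascent is replaced by a descent from \<open>m\<close>.\<close>

lemma plateau_starts_insert_block:
  assumes p: "p \<le> length \<sigma>" and m: "\<forall>v\<in>set \<sigma>. v < m" and k: "k \<ge> 1"
  shows "plateau_starts k (insert_block k m p \<sigma>) =
    (if p = 0 then {} else {p}) \<union> {j \<in> plateau_starts k \<sigma>. j + k \<le> p}
      \<union> (\<lambda>j. j + k) ` {j \<in> plateau_starts k \<sigma>. p < j}" (is "plateau_starts k ?\<tau> = ?R")
proof (intro equalityI subsetI)
  have lt: "\<sigma> ! i < m" if "i < length \<sigma>" for i
    using m that by simp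
  note nth = nth_insert_block[OF p, of _ k m]
  fix j
  {
    assume j: "j \<in> plateau_starts k ?\<tau>"
    then have j1: "1 \<le> j" "j \<le> length \<sigma>" and asc: "?\<tau> ! (j - 1) < ?\<tau> ! j"
      and plat: "\<And>t. t < k \<Longrightarrow> ?\<tau> ! (j + t) = ?\<tau> ! j"
      using p by (auto simp: plateau_starts_def length_insert_block)
    \<comment> \<open>In turn: the run ends before the block, reaches into it, is the block, starts
      later in the block or directly behind it, or starts further right.\<close>
    consider "j < p" "j + k \<le> p" | "j < p" "p < j + k" | "j = p" | "p < j" "j \<le> p + k" | "p + k < j"
      by linarith
    then show "j \<in> ?R"
    proof cases
      case 1
      have "\<sigma> ! (j + t) = \<sigma> ! j" if "t < k" for t
        using plat[OF that] that 1 j1 by (simp add: nth)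
      then have "j \<in> plateau_starts k \<sigma>"
        using asc 1 j1 p by (auto simp: plateau_starts_def nth split: if_splits)
      then show ?thesis
        using 1 by simp
    next
      case 2
      \<comment> \<open>The run would contain both an old letter and \<open>m\<close>.\<close>
      have "?\<tau> ! p = ?\<tau> ! j"
        using plat[of "p - j"] 2 by simp
      moreover have "?\<tau> ! p = m"
        using p k by (simp add: nth)
      moreover have "?\<tau> ! j < m"
        using 2 p lt[of j] by (simp add: nth)
      ultimately show ?thesis
        by simp
    next
      case 3
      then show ?thesis
        using j1 by simp
    next
      case 4
      \<comment> \<open>The preceding letter is the maximum \<open>m\<close>, so there is no ascent
        at \<open>j\<close>.\<close>
      then have "?\<tau> ! (j - 1) = m"
        using j1 by (auto simp: nth)
      moreover have "?\<tau> ! j \<le> m"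
        using 4 j1 k lt[of "j - k"] by (auto simp: nth)
      ultimately show ?thesis
        using asc by simp
    next
      case 5
      define i where "i = j - k"
      have i: "j = i + k" "p < i"
        using 5 by (auto simp: i_def)
      have len: "i + k \<le> length \<sigma>"
        using j1 i by simp
      have "\<sigma> ! (i + t) = \<sigma> ! i" if "t < k" for t
        using plat[OF that] that i len by (simp add: nth)
      moreover have "\<sigma> ! (i - 1) < \<sigma> ! i"
        using asc i len k by (auto simp: nth split: if_splits)
      ultimately have "i \<in> plateau_starts k \<sigma>"
        using i len by (simp add: plateau_starts_def)
      then show ?thesis
        using i by blast
    qed
  }
  assume "j \<in> ?R"
  then consider "p \<noteq> 0" "j = p" | "j \<in> plateau_starts k \<sigma>" "j + k \<le> p"
    | i where "i \<in> plateau_starts k \<sigma>" "p < i" "j = i + k"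
    by (auto split: if_splits)
  then show "j \<in> plateau_starts k ?\<tau>"
  proof cases
    case 1
    then show ?thesis
      using p k lt[of "p - 1"] by (simp add: plateau_starts_def nth length_insert_block)
  next
    case 2
    then show ?thesis
      using p k by (auto simp: plateau_starts_def nth length_insert_block)
  next
    case 3
    then show ?thesis
      using p k by (auto simp: plateau_starts_def nth length_insert_block)
  qed
qed

text \<open>The places where an insertion leaves \<open>ap\<close> unchanged. At place 0 the block
  has no ascent in front of it. At the \<open>k\<close> places from \<open>j\<close> on, it destroys
  the plateau starting at \<open>j\<close> and so replaces it; place \<open>j + k\<close> is
  excluded because that plateau survives there.\<close>

definition neutral_places :: "nat \<Rightarrow> nat list \<Rightarrow> nat set" where
  "neutral_places k \<sigma> = insert 0 (\<Union>j\<in>plateau_starts k \<sigma>. {j..<j + k})"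

lemma neutral_places_subset: "neutral_places k \<sigma> \<subseteq> {..length \<sigma>}"
  by (auto simp: neutral_places_def plateau_starts_def)

lemma card_neutral_places: "card (neutral_places k \<sigma>) = Suc (k * card (plateau_starts k \<sigma>))"
proof -
  have "{i..<i + k} \<inter> {j..<j + k} = {}"
    if "i \<in> plateau_starts k \<sigma>" "j \<in> plateau_starts k \<sigma>" "i \<noteq> j" for i j
  proof (cases "i < j")
    case True
    then show ?thesis
      using plateau_starts_disjoint[OF that(1,2)] by auto
  next
    case False
    then show ?thesis
      using plateau_starts_disjoint[OF that(2,1)] that(3) by auto
  qed
  then have "card (\<Union>j\<in>plateau_starts k \<sigma>. {j..<j + k}) = (\<Sum>j\<in>plateau_starts k \<sigma>. card {j..<j + k})"
    by (intro card_UN_disjoint) (auto simp: finite_plateau_starts)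
  moreover have "0 \<notin> (\<Union>j\<in>plateau_starts k \<sigma>. {j..<j + k})"
    by (auto simp: plateau_starts_def)
  ultimately show ?thesis
    by (simp add: neutral_places_def finite_plateau_starts mult.commute)
qed

text \<open>The old plateaus split into those left of the place (\<open>L\<close>), destroyed
  (\<open>D\<close>) and right of it (\<open>R\<close>); \<open>N\<close> is the new one. Only
  \<open>N\<close> and \<open>D\<close> matter for the change, and \<open>D\<close> has at most one
  element because plateaus do not overlap.\<close>

lemma ap_insert_block:
  assumes p: "p \<le> length \<sigma>" and m: "\<forall>v\<in>set \<sigma>. v < m" and k: "k \<ge> 1"
  shows "ap k (insert_block k m p \<sigma>) = (if p \<in> neutral_places k \<sigma> then ap k \<sigma> else Suc (ap k \<sigma>))"
proof -
  define P where "P = plateau_starts k \<sigma>"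
  define L where "L = {j \<in> P. j + k \<le> p}"
  define D where "D = {j \<in> P. j \<le> p \<and> p < j + k}"
  define R where "R = {j \<in> P. p < j}"
  define N where "N = (if p = 0 then {} else {p})"
  have fin: "finite P" "finite L" "finite D" "finite R" "finite N"
    by (simp_all add: P_def L_def D_def R_def N_def finite_plateau_starts)
  have "P = L \<union> D \<union> R"
    by (auto simp: L_def D_def R_def)
  moreover have "card (L \<union> D \<union> R) = card L + card D + card R"
    using fin k by (subst card_Un_disjoint, simp_all, force simp: L_def D_def R_def,
        subst card_Un_disjoint, auto simp: L_def D_def R_def)
  ultimately have old: "ap k \<sigma> = card L + card D + card R"
    by (simp add: ap_eq_card_plateau_starts[OF k] P_def)
  have "card (N \<union> L \<union> (\<lambda>j. j + k) ` R) = card (N \<union> L) + card ((\<lambda>j. j + k) ` R)"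
    using fin k by (intro card_Un_disjoint) (auto simp: N_def L_def R_def)
  also have "card (N \<union> L) = card N + card L"
    using fin k by (intro card_Un_disjoint) (auto simp: N_def L_def)
  also have "card ((\<lambda>j. j + k) ` R) = card R"
    by (simp add: card_image)
  finally have new: "ap k (insert_block k m p \<sigma>) = card N + card L + card R"
    using plateau_starts_insert_block[OF p m k]
    by (simp add: ap_eq_card_plateau_starts[OF k] P_def N_def L_def R_def)
  show ?thesis
  proof (cases "p \<in> neutral_places k \<sigma>")
    case False
    then have "p \<noteq> 0" "D = {}"
      by (auto simp: neutral_places_def D_def P_def)
    then show ?thesis
      using False old new by (simp add: N_def)
  next
    case True
    \<comment> \<open>Gain and loss balance: both sets are empty for \<open>p = 0\<close>, otherwise
      both are singletons.\<close>
    have "card N = card D"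
    proof (cases "p = 0")
      case True
      then have "D = {}"
        by (auto simp: D_def P_def plateau_starts_def)
      then show ?thesis
        using True by (simp add: N_def)
    next
      case False
      then obtain j where j: "j \<in> D"
        using True by (auto simp: neutral_places_def D_def P_def)
      have "i = j" if "i \<in> D" for i
        using that j plateau_starts_disjoint[of i k \<sigma> j] plateau_starts_disjoint[of j k \<sigma> i]
        by (fastforce simp: D_def P_def)
      then have "D = {j}"
        using j by blast
      then show ?thesis
        using False by (simp add: N_def)
    qed
    then show ?thesis
      using True old new by simp
  qed
qed

text \<open>The \<open>1 + k * ap k \<sigma>\<close> neutral places are among the
  \<open>k * n + 1\<close> places. The bound ensures that \<open>n - ap k \<sigma>\<close> is a
  genuine difference when exponents are compared later.\<close>

lemma ap_le_order:
  assumes "\<sigma> \<in> stirling_perms k n" "k \<ge> 1"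
  shows "ap k \<sigma> \<le> n"
proof -
  have "Suc (k * ap k \<sigma>) \<le> card {..length \<sigma>}"
    using card_mono[OF _ neutral_places_subset[of k \<sigma>]] assms(2)
    by (simp add: card_neutral_places ap_eq_card_plateau_starts)
  then have "k * ap k \<sigma> \<le> k * n"
    using length_stirling_perms[OF assms(1)] by simp
  then show ?thesis
    using assms(2) by simp
qed

text \<open>Each word is grouped with its insertions, split by whether the place is neutral. The
  weight \<open>f\<close> is left arbitrary so that it can take power series values.\<close>

lemma sum_stirling_perms_Suc:
  fixes f :: "nat \<Rightarrow> 'a::comm_semiring_1"
  assumes k: "k \<ge> 1"
  shows "(\<Sum>\<tau>\<in>stirling_perms k (Suc n). f (ap k \<tau>)) =
    (\<Sum>\<sigma>\<in>stirling_perms k n. of_nat (1 + k * ap k \<sigma>) * f (ap k \<sigma>)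
      + of_nat (k * (n - ap k \<sigma>)) * f (Suc (ap k \<sigma>)))"
proof -
  have "(\<Sum>\<tau>\<in>stirling_perms k (Suc n). f (ap k \<tau>)) =
      (\<Sum>(\<sigma>, p)\<in>stirling_perms k n \<times> {..k * n}. f (ap k (insert_block k (Suc n) p \<sigma>)))"
    using sum.reindex_bij_betw[OF bij_betw_insert_block[OF k, of n], of "\<lambda>\<tau>. f (ap k \<tau>)"]
    by (simp add: case_prod_unfold)
  also have "\<dots> = (\<Sum>\<sigma>\<in>stirling_perms k n. \<Sum>p\<le>k * n. f (ap k (insert_block k (Suc n) p \<sigma>)))"
    by (simp add: sum.cartesian_product)
  also have "\<dots> = (\<Sum>\<sigma>\<in>stirling_perms k n. of_nat (1 + k * ap k \<sigma>) * f (ap k \<sigma>)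
      + of_nat (k * (n - ap k \<sigma>)) * f (Suc (ap k \<sigma>)))"
  proof (rule sum.cong[OF refl])
    fix \<sigma> assume \<sigma>: "\<sigma> \<in> stirling_perms k n"
    define K where "K = neutral_places k \<sigma>"
    have len: "length \<sigma> = k * n"
      using length_stirling_perms[OF \<sigma>] .
    have K: "K \<subseteq> {..k * n}"
      using neutral_places_subset[of k \<sigma>] by (simp add: K_def len)
    have card_K: "card K = 1 + k * ap k \<sigma>"
      by (simp add: K_def card_neutral_places ap_eq_card_plateau_starts[OF k])
    have card_co_K: "card ({..k * n} - K) = k * (n - ap k \<sigma>)"
      using K card_K by (simp add: card_Diff_subset finite_subset diff_mult_distrib2)
    have "\<forall>v\<in>set \<sigma>. v < Suc n"
      using stirling_perms_letter_le[OF \<sigma>] by (simp add: less_Suc_eq_le)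
    then have ins: "ap k (insert_block k (Suc n) p \<sigma>) = (if p \<in> K then ap k \<sigma> else Suc (ap k \<sigma>))"
      if "p \<le> k * n" for p
      using ap_insert_block[of p \<sigma> "Suc n" k] that k by (simp add: len K_def)
    have "(\<Sum>p\<le>k * n. f (ap k (insert_block k (Suc n) p \<sigma>))) =
        (\<Sum>p\<in>{..k * n} - K. f (ap k (insert_block k (Suc n) p \<sigma>)))
        + (\<Sum>p\<in>K. f (ap k (insert_block k (Suc n) p \<sigma>)))"
      by (rule sum.subset_diff[OF K]) simp
    also have "(\<Sum>p\<in>{..k * n} - K. f (ap k (insert_block k (Suc n) p \<sigma>))) =
        (\<Sum>p\<in>{..k * n} - K. f (Suc (ap k \<sigma>)))"
      by (rule sum.cong) (simp_all add: ins)
    also have "(\<Sum>p\<in>K. f (ap k (insert_block k (Suc n) p \<sigma>))) = (\<Sum>p\<in>K. f (ap k \<sigma>))"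
      using K by (intro sum.cong) (auto simp: ins)
    finally show "(\<Sum>p\<le>k * n. f (ap k (insert_block k (Suc n) p \<sigma>))) =
        of_nat (1 + k * ap k \<sigma>) * f (ap k \<sigma>) + of_nat (k * (n - ap k \<sigma>)) * f (Suc (ap k \<sigma>))"
      by (simp only: sum_constant card_K card_co_K add.commute)
  qed
  finally show ?thesis .
qed

section \<open>Derivatives of the generating function\<close>

definition series_X :: "nat \<Rightarrow> rat poly fract fps" where
  "series_X k = fps_const indet_x * eulerian_base k"

text \<open>This is \<open>eulerian_base k\<close> times
  \<open>fps_exp (of_nat k * (indet_x - 1))\<close>, as the next proof shows.\<close>

definition series_U :: "nat \<Rightarrow> rat poly fract fps" where
  "series_U k = fps_const (1 - indet_x) + series_X k"

text \<open>Instead of a quotient, the product \<open>B * T = c\<close> with constant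
  \<open>c\<close> is differentiated, which gives \<open>B' T = - B T' = k c B E\<close>.\<close>

lemma deriv_eulerian_base:
  "fps_deriv (eulerian_base k) = of_nat k * eulerian_base k * series_U k"
proof -
  define B where "B = eulerian_base k"
  define c where "c = fps_const (1 - indet_x)"
  define E where "E = fps_exp (of_nat k * (indet_x - 1))"
  define T where "T = E - fps_const indet_x"
  have T0: "fps_nth T 0 \<noteq> 0"
    using indet_x_neq_1 by (simp add: T_def E_def)
  have BT: "B * T = c"
    using T0 by (simp add: B_def eulerian_base_def T_def E_def c_def fps_divide_unit
        mult.assoc inverse_mult_eq_1)
  have "fps_deriv B * T + B * fps_deriv T = 0"
    using arg_cong[OF BT, of fps_deriv] by (simp add: c_def add.commute)
  moreover have "fps_const (of_nat k * (indet_x - 1)) = of_nat k * fps_const (indet_x - 1)"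
    by (simp only: fps_of_nat[symmetric] fps_const_mult)
  then have "fps_deriv T = - (of_nat k * c * E)"
    by (simp add: T_def E_def c_def minus_diff_eq[of 1 indet_x, symmetric] fps_const_neg[symmetric]
        del: minus_diff_eq fps_const_neg)
  ultimately have "fps_deriv B * T = of_nat k * c * (B * E)"
    by (simp add: algebra_simps)
  \<comment> \<open>Expanding \<open>B * T = c\<close> with \<open>T = E - x\<close> gives
    \<open>B E = c + x B\<close>.\<close>
  also have "B * E = series_U k"
    using BT by (simp add: series_U_def series_X_def B_def[symmetric] T_def c_def algebra_simps)
  \<comment> \<open>Writing \<open>c\<close> as \<open>B * T\<close> exposes the nonzero factor
    \<open>T\<close>, which then cancels.\<close>
  also have "of_nat k * c * series_U k = of_nat k * B * series_U k * T"
    by (simp add: BT[symmetric] algebra_simps)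
  finally show ?thesis
    using T0 unfolding B_def by auto
qed

lemma deriv_series_X: "fps_deriv (series_X k) = of_nat k * series_X k * series_U k"
  by (simp add: series_X_def deriv_eulerian_base)

lemma deriv_series_U: "fps_deriv (series_U k) = of_nat k * series_X k * series_U k"
  by (simp add: series_U_def deriv_series_X)

text \<open>Differentiating \<open>F ^ k = B\<close> gives
  \<open>k F ^ (k - 1) F' = k B U = k F ^ (k - 1) F U\<close>. The common factor cancels, as
  \<open>F \<noteq> 0\<close> and the characteristic is 0.\<close>

lemma deriv_eulerian_egf:
  assumes k: "k \<ge> 1"
  shows "fps_deriv (eulerian_egf k) = eulerian_egf k * series_U k"
proof -
  define F where "F = eulerian_egf k"
  have F: "F \<noteq> 0"
    using eulerian_egf_nth_0[of k] unfolding F_def by (metis fps_zero_nth zero_neq_one)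
  have "of_nat k * F ^ (k - 1) * fps_deriv F = of_nat k * eulerian_base k * series_U k"
    using arg_cong[OF eulerian_egf_power[OF k], of fps_deriv]
    by (simp only: F_def deriv_eulerian_base fps_deriv_power fps_of_nat mult_ac)
  also have "eulerian_base k = F ^ k"
    by (simp add: F_def eulerian_egf_power[OF k])
  also have "F ^ k = F ^ (k - 1) * F"
    using k by (cases k) auto
  finally have "(of_nat k * F ^ (k - 1)) * fps_deriv F = (of_nat k * F ^ (k - 1)) * (F * series_U k)"
    by (simp add: algebra_simps)
  moreover have "of_nat k * F ^ (k - 1) \<noteq> 0"
    using F k by simp
  ultimately show ?thesis
    unfolding F_def using mult_left_cancel by blast
qed

text \<open>By the product rule \<open>F\<close> contributes a factor \<open>U\<close>, each of the
  \<open>a\<close> factors \<open>X\<close> contributes \<open>k U\<close>, and each of the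
  \<open>b\<close> factors \<open>U\<close> contributes \<open>k X\<close>. With
  \<open>b = n - a\<close> these are the insertion counts.\<close>

lemma deriv_term:
  assumes k: "k \<ge> 1"
  shows "fps_deriv (eulerian_egf k * series_X k ^ a * series_U k ^ b) =
    of_nat (1 + k * a) * (eulerian_egf k * series_X k ^ a * series_U k ^ Suc b)
    + of_nat (k * b) * (eulerian_egf k * series_X k ^ Suc a * series_U k ^ b)"
proof -
  have X: "fps_deriv (series_X k ^ a) = of_nat (k * a) * series_X k ^ a * series_U k"
    by (induction a) (simp_all add: deriv_series_X algebra_simps)
  have U: "fps_deriv (series_U k ^ b) = of_nat (k * b) * series_X k * series_U k ^ b"
    by (induction b) (simp_all add: deriv_series_U algebra_simps)
  show ?thesis
    by (simp add: X U deriv_eulerian_egf[OF k] algebra_simps)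
qed

lemma nth_deriv_eulerian_egf:
  assumes k: "k \<ge> 1"
  shows "(fps_deriv ^^ n) (eulerian_egf k) =
    (\<Sum>\<sigma>\<in>stirling_perms k n. eulerian_egf k * series_X k ^ ap k \<sigma> * series_U k ^ (n - ap k \<sigma>))"
proof (induction n)
  case 0
  have "stirling_perms k 0 = {[]}"
    by (auto simp: stirling_perms_iff stirling_word_def)
  moreover have "ap k [] = 0"
    using k by (simp add: ap_eq_card_plateau_starts plateau_starts_def)
  ultimately show ?case
    by simp
next
  case (Suc n)
  define f where
    "f a = eulerian_egf k * series_X k ^ a * series_U k ^ (Suc n - a)" for a
  have "(fps_deriv ^^ Suc n) (eulerian_egf k) =
      (\<Sum>\<sigma>\<in>stirling_perms k n. of_nat (1 + k * ap k \<sigma>) * f (ap k \<sigma>)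
        + of_nat (k * (n - ap k \<sigma>)) * f (Suc (ap k \<sigma>)))"
    \<comment> \<open>For \<open>a \<le> n\<close>, \<open>Suc n - a = Suc (n - a)\<close>, so the
      exponent \<open>Suc b\<close> in \<open>deriv_term\<close> agrees with the one in
      \<open>f a\<close>.\<close>
    using ap_le_order[OF _ k]
    by (auto simp only: funpow.simps o_apply Suc.IH fps_deriv_sum deriv_term[OF k] f_def
        Suc_diff_le diff_Suc_Suc intro!: sum.cong)
  also have "\<dots> = (\<Sum>\<tau>\<in>stirling_perms k (Suc n). f (ap k \<tau>))"
    by (rule sum_stirling_perms_Suc[OF k, symmetric])
  finally show ?case
    by (simp only: f_def)
qed

theorem theorem2:
  fixes n k :: nat
  assumes "n \<ge> 1" and "k \<ge> 2"
  shows "eulerian k n = (\<Sum>\<sigma>\<in>stirling_perms k n. indet_x ^ ap k \<sigma>)"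
proof -
  have k: "k \<ge> 1"
    using assms(2) by simp
  have X0: "fps_nth (series_X k) 0 = indet_x"
    by (simp add: series_X_def eulerian_base_nth_0)
  then have U0: "fps_nth (series_U k) 0 = 1"
    by (simp add: series_U_def)
  have "fps_nth ((fps_deriv ^^ n) (eulerian_egf k)) 0 = (\<Sum>\<sigma>\<in>stirling_perms k n. indet_x ^ ap k \<sigma>)"
    by (simp add: nth_deriv_eulerian_egf[OF k] fps_sum_nth fps_nth_power_0 X0 U0 eulerian_egf_nth_0)
  then show ?thesis
    by (simp add: eulerian_def fps_0th_higher_deriv)
qed

end
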